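(* Let $K$ be an algebraically closed field and $m\geq 4$. Then $$\mathbb{O}(m)=\begin{cases}\mathbb{L}(m)&\text{if }\operatorname{char}(K)=0,\\ \mathbb{L}_p(m)&\text{if }\operatorname{char}(K)=p>0.\end{cases}$$
   Context: $\mathcal{A}(m)$ is the set of all $K$-subalgebras $A$ of $K[x]$ such that $x^mK[x]\subset A$ and $x^{m-1}\notin A$. $\operatorname{Aut}_K(A)$ is the group of $K$-algebra automorphisms of $A$. $\mathbb{O}(m):=\{|\operatorname{Aut}_K(A)|\ :\ A\in\mathcal{A}(m),\ |\operatorname{Aut}_K(A)|<\infty\}$. $\mathbb{S}(m)$ is the set consisting of the empty set and of all non-empty subsets $\Gamma\subseteq\{2,\ldots,m-2\}$ such that $\Gamma+\Gamma\subseteq\Gamma\cup[m,\infty)$. For non-empty $\Gamma\in\mathbb{S}(m)$ and a prime $p$, $\mathbb{L}(m,\Gamma):=\{l\mid 1\leq l\leq m-1,\ l+\Gamma\not\subseteq\Gamma\cup[m,\infty)\}$ and $\mathbb{L}_p(m,\Gamma):=\{l\mid 1\leq l\leq m-1,\ p\nmid l,\ l+\Gamma\not\subseteq\Gamma\cup[m,\infty)\}$; $\mathbb{L}(m,\emptyset)=\mathbb{L}_p(m,\emptyset):=\emptyset$. $\mathbb{L}(m):=\bigcup_{\Gamma\in\mathbb{S}(m)}\mathbb{L}(m,\Gamma)$ and $\mathbb{L}_p(m):=\bigcup_{\Gamma\in\mathbb{S}(m)}\mathbb{L}_p(m,\Gamma)$. *)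

theory Defs
  imports
    "HOL-Computational_Algebra.Computational_Algebra"
    "HOL-Library.FuncSet"
    "HOL-Library.Set_Algebras"
begin

definition poly_subalgebra :: "'k::field poly set \<Rightarrow> bool" where
  "poly_subalgebra A \<longleftrightarrow>
     1 \<in> A \<and>
     (\<forall>f\<in>A. \<forall>g\<in>A. f + g \<in> A) \<and>
     (\<forall>f\<in>A. \<forall>g\<in>A. f * g \<in> A) \<and>
     (\<forall>c. \<forall>f\<in>A. smult c f \<in> A)"

definition subalgebras :: "nat \<Rightarrow> 'k::field poly set set" where
  "subalgebras m = {A. poly_subalgebra A \<and> range (\<lambda>f. monom 1 m * f) \<subseteq> A \<and> monom 1 (m - 1) \<notin> A}"

text \<open>
  Automorphisms are maps on \<open>A\<close> only; \<open>extensional A\<close> fixes their value outside \<open>A\<close>, so that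
  the cardinality of this set is the order of the automorphism group.
\<close>
definition alg_automorphisms :: "'k::field poly set \<Rightarrow> ('k poly \<Rightarrow> 'k poly) set" where
  "alg_automorphisms A = {\<sigma> \<in> extensional A.
     bij_betw \<sigma> A A \<and>
     \<sigma> 1 = 1 \<and>
     (\<forall>f\<in>A. \<forall>g\<in>A. \<sigma> (f + g) = \<sigma> f + \<sigma> g) \<and>
     (\<forall>f\<in>A. \<forall>g\<in>A. \<sigma> (f * g) = \<sigma> f * \<sigma> g) \<and>
     (\<forall>c. \<forall>f\<in>A. \<sigma> (smult c f) = smult c (\<sigma> f))}"

text \<open>The \<open>itself\<close> argument selects the ground field.\<close>
definition aut_orders :: "'k::field itself \<Rightarrow> nat \<Rightarrow> nat set" where
  "aut_orders _ m =
     {card (alg_automorphisms A) | A :: 'k poly set.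
        A \<in> subalgebras m \<and> finite (alg_automorphisms A)}"

text \<open>The empty set satisfies both conditions, hence is a member.\<close>
definition truncated_semigroups :: "nat \<Rightarrow> nat set set" where
  "truncated_semigroups m = {\<Gamma>. \<Gamma> \<subseteq> {2..m - 2} \<and> \<Gamma> + \<Gamma> \<subseteq> \<Gamma> \<union> {m..}}"

text \<open>For \<open>\<Gamma> = {}\<close> the two sets below are empty, because the translate \<open>l +o {}\<close> is empty.\<close>
definition escaping_shifts :: "nat \<Rightarrow> nat set \<Rightarrow> nat set" where
  "escaping_shifts m \<Gamma> = {l. 1 \<le> l \<and> l \<le> m - 1 \<and> \<not> l +o \<Gamma> \<subseteq> \<Gamma> \<union> {m..}}"

definition escaping_shifts_prime_to :: "nat \<Rightarrow> nat \<Rightarrow> nat set \<Rightarrow> nat set" where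
  "escaping_shifts_prime_to p m \<Gamma> =
     {l. 1 \<le> l \<and> l \<le> m - 1 \<and> \<not> p dvd l \<and> \<not> l +o \<Gamma> \<subseteq> \<Gamma> \<union> {m..}}"

definition all_escaping_shifts :: "nat \<Rightarrow> nat set" where
  "all_escaping_shifts m = (\<Union>\<Gamma>\<in>truncated_semigroups m. escaping_shifts m \<Gamma>)"

definition all_escaping_shifts_prime_to :: "nat \<Rightarrow> nat \<Rightarrow> nat set" where
  "all_escaping_shifts_prime_to p m =
     (\<Union>\<Gamma>\<in>truncated_semigroups m. escaping_shifts_prime_to p m \<Gamma>)"

end

theory Submission
  imports Defs
begin

text \<open>
  Every automorphism of \<open>A\<close> is a dilation \<open>p(x) \<mapsto> p(c x)\<close>, so the automorphism group is a subgroup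
  of the multiplicative group of \<open>K\<close>; if finite, it is the group of \<open>n\<close>-th roots of unity for some
  \<open>n\<close> not divisible by the characteristic. If \<open>n\<close> did not escape from the set \<open>\<Gamma>\<close> of positive
  orders below \<open>m\<close> of elements of \<open>A\<close>, then \<open>A\<close> would be spanned by monomials and all dilations
  would preserve it. Conversely, if \<open>g \<in> \<Gamma>\<close> and \<open>g + l\<close> lies neither in \<open>\<Gamma>\<close> nor in \<open>{m..}\<close>, then
  the dilations preserving \<open>K[x ^ g + x ^ (g + l)] + x ^ m K[x]\<close> are those with \<open>c ^ l = 1\<close>.
\<close>

section \<open>Dilations of K[x] and their stabilizers\<close>

definition dilate :: "'k::field \<Rightarrow> 'k poly \<Rightarrow> 'k poly" where
  "dilate c p = pcompose p [:0, c:]"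

lemma coeff_dilate [simp]: "coeff (dilate c p) i = c ^ i * coeff p i"
  by (simp add: dilate_def coeff_pcompose_linear)

lemma dilate_add [simp]: "dilate c (p + q) = dilate c p + dilate c q"
  by (simp add: dilate_def pcompose_add)

lemma dilate_mult [simp]: "dilate c (p * q) = dilate c p * dilate c q"
  by (simp add: dilate_def pcompose_mult)

lemma dilate_smult [simp]: "dilate c (smult a p) = smult a (dilate c p)"
  by (simp add: dilate_def pcompose_smult)

lemma dilate_1 [simp]: "dilate c 1 = 1"
  by (simp add: dilate_def pcompose_1)

lemma dilate_by_1 [simp]: "dilate 1 p = p"
  by (simp add: poly_eq_iff)

lemma dilate_dilate: "dilate c (dilate d p) = dilate (c * d) p"
  by (simp add: poly_eq_iff power_mult_distrib)

lemma dilate_inject: "c \<noteq> 0 \<Longrightarrow> dilate c p = dilate c q \<longleftrightarrow> p = q"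
  by (simp add: poly_eq_iff)

text \<open>Membership is an equivalence rather than an implication, so that the dilation maps
  \<open>A\<close> onto itself and not merely into itself.\<close>

definition dilation_stabilizer :: "'k::field poly set \<Rightarrow> 'k set" where
  "dilation_stabilizer A = {c. c \<noteq> 0 \<and> (\<forall>p. dilate c p \<in> A \<longleftrightarrow> p \<in> A)}"

lemma dilation_stabilizerI:
  assumes "c \<noteq> 0" "\<And>p. p \<in> A \<Longrightarrow> dilate c p \<in> A" "\<And>p. p \<in> A \<Longrightarrow> dilate (inverse c) p \<in> A"
  shows "c \<in> dilation_stabilizer A"
proof -
  have "p \<in> A" if "dilate c p \<in> A" for p
    using assms(3)[OF that] assms(1) by (simp add: dilate_dilate)
  then show ?thesis
    using assms unfolding dilation_stabilizer_def by blast
qed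

lemma one_in_dilation_stabilizer: "1 \<in> dilation_stabilizer A"
  by (simp add: dilation_stabilizer_def)

lemma mult_in_dilation_stabilizer:
  "c \<in> dilation_stabilizer A \<Longrightarrow> d \<in> dilation_stabilizer A \<Longrightarrow> c * d \<in> dilation_stabilizer A"
  unfolding dilation_stabilizer_def mem_Collect_eq by (metis dilate_dilate mult_eq_0_iff)

section \<open>Closure properties of the subalgebras\<close>

lemma poly_subalgebra_0: "poly_subalgebra A \<Longrightarrow> 0 \<in> A"
  unfolding poly_subalgebra_def by (metis smult_0_left)

lemma poly_subalgebra_diff: "poly_subalgebra A \<Longrightarrow> p \<in> A \<Longrightarrow> q \<in> A \<Longrightarrow> p - q \<in> A"
  unfolding poly_subalgebra_def
  by (metis diff_conv_add_uminus smult_1_left smult_minus_left)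

lemma poly_subalgebra_sum:
  assumes "poly_subalgebra A" "\<And>i. i \<in> I \<Longrightarrow> f i \<in> A"
  shows "sum f I \<in> A"
  using assms(2)
proof (induction I rule: infinite_finite_induct)
  case (insert i I)
  then show ?case using assms(1) by (auto simp: poly_subalgebra_def)
qed (use assms poly_subalgebra_0 in auto)

lemma subalgebras_contains_high_order:
  assumes "A \<in> subalgebras m" "\<And>i. i < m \<Longrightarrow> coeff p i = 0"
  shows "p \<in> A"
proof -
  have "monom 1 m dvd p"
    using assms(2) by (simp add: monom_1_dvd_iff')
  then show ?thesis
    using assms(1) by (auto simp: subalgebras_def dvd_def)
qed

text \<open>An element of order \<open>m - 1\<close> differs from a nonzero multiple of
  \<open>x ^ (m - 1)\<close> by an element of \<open>x ^ m K[x]\<close>, so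
  \<open>x ^ (m - 1)\<close> would itself lie in \<open>A\<close>.\<close>

lemma subalgebras_no_order_pred:
  assumes "A \<in> subalgebras m" "p \<in> A" "\<And>i. i < m - 1 \<Longrightarrow> coeff p i = 0"
  shows "coeff p (m - 1) = 0"
proof (rule ccontr)
  assume nz: "coeff p (m - 1) \<noteq> 0"
  define q where "q = p - smult (coeff p (m - 1)) (monom 1 (m - 1))"
  have sub: "poly_subalgebra A"
    using assms(1) by (simp add: subalgebras_def)
  have "coeff q i = 0" if "i < m" for i
    using that assms(3)[of i] by (cases "i = m - 1") (auto simp: q_def)
  then have "p - q \<in> A"
    using subalgebras_contains_high_order[OF assms(1)] poly_subalgebra_diff[OF sub assms(2)] by blast
  then have "smult (inverse (coeff p (m - 1))) (p - q) \<in> A"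
    using sub by (simp add: poly_subalgebra_def)
  then show False
    using nz assms(1) by (simp add: q_def subalgebras_def)
qed

section \<open>Automorphisms are dilations\<close>

text \<open>A root \<open>a\<close> of \<open>p\<close> is also a root of \<open>q\<close>. The
  linear factor of \<open>a\<close> splits off both polynomials, its \<open>n\<close>-th power
  cancels in the hypothesis, and induction on the degree of \<open>p\<close> applies.\<close>

lemma power_dvd_power_imp_dvd:
  fixes p q :: "'k::alg_closed_field poly"
  assumes "p ^ n dvd q ^ n" "n > 0"
  shows "p dvd q"
  using assms(1)
proof (induction "degree p" arbitrary: p q)
  case 0
  then obtain c where c: "p = [:c:]"
    by (metis degree_eq_zeroE)
  show ?case
  proof (cases "c = 0")
    case True
    then show ?thesis using 0 c assms(2) by (simp add: zero_power)
  next
    case False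
    then show ?thesis using c by (simp add: const_poly_dvd_iff dvd_field_iff)
  qed
next
  case (Suc d)
  then obtain a where a: "poly p a = 0"
    by (metis alg_closed_imp_poly_has_root zero_less_Suc)
  then obtain p' where p': "p = [:-a, 1:] * p'"
    by (auto simp: poly_eq_0_iff_dvd elim: dvdE)
  have "poly (q ^ n) a = 0"
    using Suc.prems a assms(2) by (metis dvd_trans dvd_power poly_eq_0_iff_dvd)
  then have "poly q a = 0"
    by simp
  then obtain q' where q': "q = [:-a, 1:] * q'"
    by (auto simp: poly_eq_0_iff_dvd elim: dvdE)
  have "p' \<noteq> 0"
    using p' Suc.hyps(2) by auto
  then have "degree p = Suc (degree p')"
    unfolding p' by (subst degree_mult_eq) auto
  then have "d = degree p'"
    using Suc.hyps(2) by simp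
  moreover have "p' ^ n dvd q' ^ n"
    using Suc.prems unfolding p' q' power_mult_distrib by (subst (asm) dvd_mult_cancel_left) simp
  ultimately have "p' dvd q'"
    using Suc.hyps(1) by blast
  then show ?case
    unfolding p' q' by (rule mult_dvd_mono[OF dvd_refl])
qed

text \<open>
  Since \<open>\<sigma> (x ^ m) ^ (m + 1) = \<sigma> (x ^ (m + 1)) ^ m\<close> and \<open>K[x]\<close> is integrally closed,
  \<open>\<sigma> (x ^ m) = h ^ m\<close> and \<open>\<sigma> (x ^ (m + 1)) = h ^ (m + 1)\<close> for a single polynomial \<open>h\<close>.
\<close>
lemma alg_automorphism_pcompose:
  fixes A :: "'k::alg_closed_field poly set"
  assumes A: "A \<in> subalgebras m" and "m > 0" and \<sigma>: "\<sigma> \<in> alg_automorphisms A"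
  obtains h where "h \<noteq> 0" "\<And>p. p \<in> A \<Longrightarrow> \<sigma> p = pcompose p h"
proof -
  let ?X = "monom (1::'k)"
  have sub: "poly_subalgebra A"
    using A by (simp add: subalgebras_def)
  have bij: "bij_betw \<sigma> A A" and \<sigma>1: "\<sigma> 1 = 1"
    and add: "\<And>f g. f \<in> A \<Longrightarrow> g \<in> A \<Longrightarrow> \<sigma> (f + g) = \<sigma> f + \<sigma> g"
    and mult: "\<And>f g. f \<in> A \<Longrightarrow> g \<in> A \<Longrightarrow> \<sigma> (f * g) = \<sigma> f * \<sigma> g"
    and smult: "\<And>c f. f \<in> A \<Longrightarrow> \<sigma> (smult c f) = smult c (\<sigma> f)"
    using \<sigma> by (auto simp: alg_automorphisms_def)
  have mA: "p * q \<in> A" if "p \<in> A" "q \<in> A" for p q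
    using sub that by (simp add: poly_subalgebra_def)
  have powA: "p ^ k \<in> A" if "p \<in> A" for p k
    using sub that by (induction k) (auto simp: poly_subalgebra_def)
  have pow: "\<sigma> (p ^ k) = \<sigma> p ^ k" if "p \<in> A" for p k
    using that by (induction k) (simp_all add: \<sigma>1 mult powA)
  have XA: "?X i \<in> A" if "i \<ge> m" for i
    using that by (intro subalgebras_contains_high_order[OF A]) auto
  have s0: "\<sigma> 0 = 0"
    using smult[OF poly_subalgebra_0[OF sub], of 0] by simp
  define F G where "F = \<sigma> (?X m)" and "G = \<sigma> (?X (m + 1))"
  have F0: "F \<noteq> 0"
    using bij XA[of m] s0 poly_subalgebra_0[OF sub] monom_eq_0_iff[of "1::'k" m]
    unfolding F_def bij_betw_def inj_on_def by (metis order_refl zero_neq_one)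
  have "?X m ^ (m + 1) = ?X (m + 1) ^ m"
    by (simp only: monom_power power_one mult.commute)
  then have FG: "F ^ (m + 1) = G ^ m"
    unfolding F_def G_def using XA by (metis pow le_add1 order_refl)
  then have "F ^ m dvd G ^ m"
    by (metis dvd_triv_right power_add power_one_right mult.commute)
  then obtain h where h: "G = F * h"
    using power_dvd_power_imp_dvd \<open>m > 0\<close> by (metis dvdE)
  have "F ^ m * F = F ^ m * h ^ m"
    using FG h by (simp add: power_mult_distrib mult.commute)
  then have Fh: "F = h ^ m"
    using F0 by simp
  then have Gh: "G = h ^ (m + 1)"
    using h by simp
  have h0: "h \<noteq> 0"
    using Fh F0 \<open>m > 0\<close> by auto
  have X: "\<sigma> (?X (m + j)) = h ^ (m + j)" for j
  proof (cases j)
    case 0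
    then show ?thesis using Fh by (simp add: F_def)
  next
    case (Suc i)
    \<comment> \<open>With \<open>i = j - 1\<close> both exponents are \<open>(m + 1) * j\<close>;
      multiplying by a power of \<open>x ^ m\<close> thus expresses \<open>x ^ (m + j)\<close>
      through the two monomials whose images are known.\<close>
    have "?X (m + j) * ?X m ^ i = ?X (m + 1) ^ j"
      by (simp add: monom_power mult_monom Suc algebra_simps)
    then have "\<sigma> (?X (m + j)) * F ^ i = G ^ j"
      unfolding F_def G_def using XA powA pow mult by (metis le_add1 order_refl)
    also have "\<dots> = h ^ (m + j) * F ^ i"
      by (simp add: Fh Gh Suc algebra_simps flip: power_mult power_add)
    finally show ?thesis
      using F0 by simp
  qed
  have Xh: "pcompose (?X i) h = h ^ i" for i
    by (induction i) (simp_all add: monom_0 monom_Suc pcompose_pCons)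
  \<comment> \<open>The exponent \<open>j\<close> has to vary, since splitting off the constant
    coefficient of the cofactor raises it by one.\<close>
  have high: "\<sigma> (?X (m + j) * q) = pcompose (?X (m + j) * q) h" for j q
  proof (induction q arbitrary: j)
    case 0
    then show ?case by (simp add: s0)
  next
    case (pCons a q)
    have split: "?X (m + j) * pCons a q = smult a (?X (m + j)) + ?X (m + Suc j) * q"
      by (simp add: monom_Suc mult_pCons_left mult_pCons_right)
    have "?X (m + Suc j) * q \<in> A"
      by (intro subalgebras_contains_high_order[OF A]) (simp add: coeff_monom_mult)
    moreover have "smult a (?X (m + j)) \<in> A"
      using sub XA by (simp add: poly_subalgebra_def)
    ultimately have "\<sigma> (?X (m + j) * pCons a q) = smult a (h ^ (m + j)) + pcompose (?X (m + Suc j) * q) h"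
      unfolding split using add smult X XA pCons.IH by (metis le_add1)
    then show ?case
      unfolding split by (simp only: pcompose_add pcompose_smult Xh)
  qed
  have "\<sigma> p = pcompose p h" if "p \<in> A" for p
  proof -
    \<comment> \<open>Multiplication by \<open>x ^ m\<close> moves \<open>p\<close> into
      \<open>x ^ m K[x]\<close>, where \<sigma> is known to be composition with \<open>h\<close>;
      the factor \<open>h ^ m\<close> then cancels.\<close>
    have "h ^ m * \<sigma> p = h ^ m * pcompose p h"
      using high[of 0 p] mult[OF XA that] X[of 0] by (simp add: pcompose_mult Xh)
    then show ?thesis
      using h0 by simp
  qed
  then show ?thesis
    using that h0 by blast
qed

text \<open>By surjectivity \<open>x ^ m\<close> and \<open>x ^ (m + 1)\<close> are composites with
  \<open>h\<close>, so \<open>degree h\<close> divides both \<open>m\<close> and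
  \<open>m + 1\<close>, and \<open>h\<close> is linear. Its constant term vanishes because
  \<open>A\<close> has no element of order \<open>m - 1\<close>.\<close>

lemma alg_automorphism_dilate:
  fixes A :: "'k::alg_closed_field poly set"
  assumes A: "A \<in> subalgebras m" and "m > 0" and \<sigma>: "\<sigma> \<in> alg_automorphisms A"
  obtains c where "c \<noteq> 0" "\<And>p. p \<in> A \<Longrightarrow> \<sigma> p = dilate c p"
proof -
  let ?X = "monom (1::'k)"
  obtain h where h: "h \<noteq> 0" "\<And>p. p \<in> A \<Longrightarrow> \<sigma> p = pcompose p h"
    using alg_automorphism_pcompose[OF assms] by blast
  have surj: "\<sigma> ` A = A"
    using \<sigma> by (auto simp: alg_automorphisms_def bij_betw_def)
  have "degree h dvd i" if "i \<ge> m" for i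
  proof -
    have "?X i \<in> A"
      using that by (intro subalgebras_contains_high_order[OF A]) auto
    then obtain p where "?X i = pcompose p h"
      using surj h(2) by (metis imageE)
    then have "i = degree p * degree h"
      by (metis degree_pcompose degree_monom_eq zero_neq_one)
    then show ?thesis by simp
  qed
  from this[of m] this[of "Suc m"] have "degree h = 1"
    by (metis One_nat_def Suc_n_not_le_n le_SucI order_refl dvd_1_iff_1 dvd_add_right_iff plus_1_eq_Suc add.commute)
  then obtain b c where bc: "h = [:b, c:]" "c \<noteq> 0"
    by (metis degree1_coeffs)
  have "b = 0"
  proof (rule ccontr)
    assume "b \<noteq> 0"
    \<comment> \<open>\<open>r\<close> is the compositional inverse of \<open>h\<close>. The
      polynomial \<open>p\<close> below is a multiple of \<open>x ^ m\<close>, and its composite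
      with \<open>h\<close> is \<open>x ^ (m - 1) * h ^ m\<close>, which has order exactly
      \<open>m - 1\<close> when \<open>b\<close> is nonzero.\<close>
    define r where "r = [:- b / c, 1 / c:]"
    have rh: "pcompose r h = [:0, 1:]"
      using bc by (simp add: r_def pcompose_pCons)
    have pow: "pcompose (p ^ i) h = pcompose p h ^ i" for p i
      by (induction i) (simp_all add: pcompose_1 pcompose_mult)
    define p where "p = ?X m * r ^ (m - 1)"
    have "p \<in> A"
      unfolding p_def
      by (intro subalgebras_contains_high_order[OF A]) (simp add: coeff_monom_mult)
    then have "pcompose p h \<in> A"
      using surj h(2) by (metis imageI)
    also have "pcompose p h = ?X (m - 1) * h ^ m"
      by (simp only: p_def pcompose_mult pow rh monom_altdef smult_1_left) (simp add: pcompose_pCons mult.commute)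
    finally have "coeff (?X (m - 1) * h ^ m) (m - 1) = 0"
      by (intro subalgebras_no_order_pred[OF A]) (auto simp: coeff_monom_mult)
    then show False
      using \<open>b \<noteq> 0\<close> bc by (simp add: coeff_monom_mult coeff_0_power)
  qed
  then show ?thesis
    using that[of c] bc h(2) by (simp add: dilate_def)
qed

lemma bij_betw_dilation_stabilizer_alg_automorphisms:
  fixes A :: "'k::alg_closed_field poly set"
  assumes A: "A \<in> subalgebras m" and "m > 0"
  shows "bij_betw (\<lambda>c. restrict (dilate c) A) (dilation_stabilizer A) (alg_automorphisms A)"
proof (rule bij_betw_imageI)
  have sub: "poly_subalgebra A"
    using A by (simp add: subalgebras_def)
  show "inj_on (\<lambda>c. restrict (dilate c) A) (dilation_stabilizer A)"
  proof (rule inj_onI)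
    fix c d
    assume c: "c \<in> dilation_stabilizer A" and eq: "restrict (dilate c) A = restrict (dilate d) A"
    \<comment> \<open>The scalar can be recovered from its action on \<open>x ^ m\<close> and
      \<open>x ^ (m + 1)\<close> as a quotient of consecutive powers.\<close>
    have "c ^ i = d ^ i" if "i \<ge> m" for i
    proof -
      have "monom 1 i \<in> A"
        using that by (intro subalgebras_contains_high_order[OF A]) auto
      then have "dilate c (monom 1 i) = dilate d (monom 1 i)"
        using eq by (metis restrict_apply')
      then have "coeff (dilate c (monom 1 i)) i = coeff (dilate d (monom 1 i)) i"
        by simp
      then show ?thesis by simp
    qed
    from this[of m] this[of "Suc m"] have "c ^ m = d ^ m" "c * c ^ m = d * d ^ m"
      by auto
    moreover have "c ^ m \<noteq> 0"
      using c by (simp add: dilation_stabilizer_def)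
    ultimately show "c = d"
      by (metis mult_right_cancel)
  qed
  show "(\<lambda>c. restrict (dilate c) A) ` dilation_stabilizer A = alg_automorphisms A"
  proof (intro equalityI subsetI)
    fix \<sigma> assume "\<sigma> \<in> (\<lambda>c. restrict (dilate c) A) ` dilation_stabilizer A"
    then obtain c where c: "c \<noteq> 0" "\<And>p. dilate c p \<in> A \<longleftrightarrow> p \<in> A" "\<sigma> = restrict (dilate c) A"
      by (auto simp: dilation_stabilizer_def)
    have "p \<in> dilate c ` A" if "p \<in> A" for p
      using c(1) c(2)[of "dilate (inverse c) p"] that
      by (intro image_eqI[of _ _ "dilate (inverse c) p"]) (simp_all add: dilate_dilate)
    then have "bij_betw (dilate c) A A"
      using c by (auto simp: bij_betw_def inj_on_def dilate_inject)
    then show "\<sigma> \<in> alg_automorphisms A"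
      using sub by (auto simp: c(3) alg_automorphisms_def poly_subalgebra_def cong: bij_betw_cong)
  next
    fix \<sigma> assume \<sigma>: "\<sigma> \<in> alg_automorphisms A"
    obtain c where c: "c \<noteq> 0" "\<And>p. p \<in> A \<Longrightarrow> \<sigma> p = dilate c p"
      using alg_automorphism_dilate[OF assms \<sigma>] by blast
    have bij: "\<sigma> ` A = A" and ext: "\<sigma> \<in> extensional A"
      using \<sigma> by (auto simp: alg_automorphisms_def bij_betw_def)
    have "p \<in> A" if "dilate c p \<in> A" for p
    proof -
      from that bij obtain q where q: "q \<in> A" "dilate c p = \<sigma> q"
        by (metis imageE)
      then have "p = q"
        using c by (simp add: dilate_inject)
      then show ?thesis using q by simp
    qed
    then have "c \<in> dilation_stabilizer A"
      using c bij by (auto simp: dilation_stabilizer_def)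
    moreover have "\<sigma> = restrict (dilate c) A"
      using c ext by (intro extensionalityI[of _ A]) auto
    ultimately show "\<sigma> \<in> (\<lambda>c. restrict (dilate c) A) ` dilation_stabilizer A"
      by blast
  qed
qed

section \<open>Roots of unity and finite multiplicative groups\<close>

lemma roots_of_unity_bound:
  fixes n :: nat
  assumes "n > 0"
  shows "finite {x::'k::field. x ^ n = 1}" "card {x::'k. x ^ n = 1} \<le> n"
proof -
  define p :: "'k poly" where "p = monom 1 n - 1"
  have "coeff p n = 1"
    using assms by (simp add: p_def)
  then have p0: "p \<noteq> 0"
    by auto
  have deg: "degree p \<le> n"
    by (simp add: p_def degree_diff_le degree_monom_le)
  have eq: "{x::'k. x ^ n = 1} = {x. poly p x = 0}"
    by (simp add: p_def poly_monom)
  show "finite {x::'k. x ^ n = 1}"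
    unfolding eq using p0 by (rule poly_roots_finite)
  show "card {x::'k. x ^ n = 1} \<le> n"
    unfolding eq using card_poly_roots_bound[OF p0] deg by simp
qed

text \<open>The polynomial \<open>x ^ n - 1\<close> splits, and its derivative
  \<open>n * x ^ (n - 1)\<close> vanishes at none of its roots, so every root is simple.\<close>

lemma card_roots_of_unity:
  fixes n :: nat
  assumes n: "of_nat n \<noteq> (0::'k::alg_closed_field)"
  shows "card {x::'k. x ^ n = 1} = n"
proof -
  have "n > 0"
    using n by (cases n) auto
  define p :: "'k poly" where "p = monom 1 n - 1"
  have "coeff p n = 1"
    using \<open>n > 0\<close> by (simp add: p_def)
  moreover from this have deg: "degree p = n"
    by (intro antisym le_degree) (simp_all add: p_def degree_diff_le degree_monom_le)
  ultimately have lead: "lead_coeff p = 1" and p0: "p \<noteq> 0"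
    by auto
  obtain M where M: "size M = n" "p = (\<Prod>x\<in>#M. [:-x, 1:])"
    using alg_closed_imp_factorization[OF p0] deg lead by auto
  have "count M a = 1" if a: "a \<in># M" for a
  proof -
    obtain N where N: "M = add_mset a N"
      using a by (meson mset_add)
    define q where "q = (\<Prod>x\<in>#N. [:-x, 1:])"
    have pq: "p = [:-a, 1:] * q"
      unfolding M q_def N by simp
    then have "poly p a = 0"
      by simp
    then have "a ^ n = 1"
      by (simp add: p_def poly_monom)
    then have "a \<noteq> 0"
      using \<open>n > 0\<close> by (auto simp: zero_power)
    have "poly (pderiv p) a = of_nat n * a ^ (n - 1)"
      by (simp add: p_def pderiv_diff pderiv_monom poly_monom)
    moreover have "poly (pderiv p) a = poly q a"
      unfolding pq by (simp only: pderiv_mult) (simp add: pderiv_pCons)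
    ultimately have "poly q a \<noteq> 0"
      using n \<open>a \<noteq> 0\<close> by simp
    then have "a \<notin># N"
      by (auto simp: q_def poly_prod_mset image_iff)
    then show ?thesis
      by (simp add: N not_in_iff)
  qed
  then have "size M = card (set_mset M)"
    by (simp add: size_multiset_overloaded_eq)
  moreover have "set_mset M = {x. poly p x = 0}"
    by (auto simp: M(2) poly_prod_mset image_iff)
  ultimately show ?thesis
    using M(1) by (simp add: p_def poly_monom)
qed

text \<open>Multiplication by an element of \<open>G\<close> permutes \<open>G\<close>, and
  comparing the products over \<open>G\<close> shows that the element is a root of unity of exponent
  \<open>card G\<close>. There are at most \<open>card G\<close> such roots.\<close>

lemma finite_mult_group_eq_roots_of_unity:
  fixes G :: "'k::field set"
  assumes "finite G" "1 \<in> G" "0 \<notin> G" "\<And>x y. x \<in> G \<Longrightarrow> y \<in> G \<Longrightarrow> x * y \<in> G"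
  shows "G = {x. x ^ card G = 1}"
proof (rule card_seteq)
  have "card G > 0"
    using assms card_gt_0_iff by blast
  then show "finite {x::'k. x ^ card G = 1}" "card {x::'k. x ^ card G = 1} \<le> card G"
    by (rule roots_of_unity_bound)+
  show "G \<subseteq> {x. x ^ card G = 1}"
  proof
    fix x assume x: "x \<in> G"
    then have "x \<noteq> 0"
      using assms by blast
    then have inj: "inj_on ((*) x) G"
      by (simp add: inj_on_def)
    have "(*) x ` G \<subseteq> G"
      using assms x by blast
    then have "(*) x ` G = G"
      using inj assms(1) by (metis endo_inj_surj)
    then have "\<Prod>G = (\<Prod>y\<in>G. x * y)"
      using inj by (metis prod.reindex_cong)
    also have "\<dots> = x ^ card G * \<Prod>G"
      by (simp add: prod.distrib)
    finally have "x ^ card G * \<Prod>G = 1 * \<Prod>G"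
      by simp
    moreover have "\<Prod>G \<noteq> 0"
      using assms by (metis prod_zero_iff)
    ultimately show "x \<in> {x. x ^ card G = 1}"
      by simp
  qed
qed

text \<open>Frobenius gives \<open>x ^ p - 1 = (x - 1) ^ p\<close> for the characteristic
  \<open>p\<close>.\<close>

lemma power_CHAR_eq_1_imp:
  fixes x :: "'k::field"
  assumes "x ^ CHAR('k) = 1" "CHAR('k) > 0"
  shows "x = 1"
proof -
  have "x ^ CHAR('k) = (x - 1 + 1) ^ CHAR('k)"
    by simp
  also have "\<dots> = (x - 1) ^ CHAR('k) + 1"
    using assms(2) by (subst freshmans_dream) (auto intro: prime_CHAR_semidom)
  finally show ?thesis
    using assms by simp
qed

text \<open>If \<open>n = p * k\<close> for the characteristic \<open>p\<close>, then every
  \<open>n\<close>-th root of unity is a \<open>k\<close>-th root, and there are at most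
  \<open>k < n\<close> of those. In characteristic 0 the claim reads that \<open>n\<close> is
  nonzero.\<close>

lemma CHAR_not_dvd_card_roots_of_unity:
  assumes "card {x::'k::field. x ^ n = 1} = n" "n > 0"
  shows "\<not> CHAR('k) dvd n"
proof
  assume "CHAR('k) dvd n"
  then obtain k where k: "n = CHAR('k) * k"
    by (rule dvdE)
  with assms(2) have pos: "CHAR('k) > 0" "k > 0"
    by auto
  have "{x::'k. x ^ n = 1} = {x. x ^ k = 1}"
    using power_CHAR_eq_1_imp[OF _ pos(1)] unfolding k by (auto simp: power_mult mult.commute[of "CHAR('k)"])
  then have "n \<le> k"
    using assms(1) roots_of_unity_bound(2)[OF pos(2), where 'k = 'k] by simp
  moreover have "CHAR('k) \<noteq> 1"
    by simp
  ultimately show False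
    using k pos by (cases "CHAR('k)") auto
qed

text \<open>If \<open>n\<close> does not divide \<open>k\<close>, the residue \<open>r\<close> of
  \<open>k\<close> is positive and fewer than \<open>n\<close> elements are \<open>r\<close>-th
  roots of unity, so some \<open>n\<close>-th root \<open>z\<close> has \<open>z ^ k\<close>
  different from 1. Multiplication by \<open>z\<close> permutes the summation set and scales the sum
  by \<open>z ^ k\<close>, so the sum is 0.\<close>

lemma sum_power_roots_of_unity:
  fixes n :: nat
  assumes n: "card {x::'k::field. x ^ n = 1} = n" "n > 0"
  shows "(\<Sum>x | x ^ n = 1. x ^ k) = (if n dvd k then of_nat n else (0::'k))"
proof (cases "n dvd k")
  case True
  then have "(\<Sum>x | x ^ n = 1. x ^ k) = (\<Sum>x::'k | x ^ n = 1. (1::'k))"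
    by (intro sum.cong) (auto elim!: dvdE simp: power_mult)
  then show ?thesis
    using True n by simp
next
  case False
  define r where "r = k mod n"
  have r: "0 < r" "r < n"
    using False n by (auto simp: r_def dvd_eq_mod_eq_0)
  have xr: "x ^ k = x ^ r" if "x ^ n = 1" for x :: 'k
  proof -
    have "x ^ k = (x ^ n) ^ (k div n) * x ^ r"
      unfolding r_def power_mult[symmetric] power_add[symmetric] by simp
    then show ?thesis using that by simp
  qed
  have "\<not> {x::'k. x ^ n = 1} \<subseteq> {x. x ^ r = 1}"
    using card_mono[OF roots_of_unity_bound(1)[OF r(1)], of "{x::'k. x ^ n = 1}"]
      roots_of_unity_bound(2)[OF r(1), where 'k = 'k] n r by linarith
  then obtain z :: 'k where z: "z ^ n = 1" "z ^ k \<noteq> 1"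
    using xr by auto
  then have "z \<noteq> 0"
    using n by (auto simp: zero_power)
  have "bij_betw ((*) z) {x. x ^ n = 1} {x. x ^ n = 1}"
    by (rule bij_betw_byWitness[where f' = "(*) (inverse z)"])
      (use z \<open>z \<noteq> 0\<close> in \<open>auto simp: power_mult_distrib power_inverse\<close>)
  then have "(\<Sum>x | x ^ n = 1. x ^ k) = (\<Sum>x | x ^ n = 1. (z * x) ^ k)"
    by (rule sum.reindex_bij_betw[symmetric])
  also have "\<dots> = z ^ k * (\<Sum>x | x ^ n = 1. x ^ k)"
    by (simp add: power_mult_distrib sum_distrib_left)
  finally show ?thesis
    using z(2) False by simp
qed

section \<open>Orders of elements of a subalgebra\<close>

text \<open>This is the value semigroup of \<open>A\<close> for the \<open>x\<close>-adic valuation,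
  without 0 and truncated at \<open>m\<close>.\<close>

definition order_set :: "nat \<Rightarrow> 'k::field poly set \<Rightarrow> nat set" where
  "order_set m A =
     {k. 1 \<le> k \<and> k < m \<and> (\<exists>p\<in>A. coeff p k \<noteq> 0 \<and> (\<forall>i<k. coeff p i = 0))}"

lemma coeff_mult_lowest:
  assumes "\<forall>i<j. coeff p i = 0" "\<forall>i<k. coeff q i = (0::'a::field)"
  shows "coeff (p * q) (j + k) = coeff p j * coeff q k" "\<forall>i<j + k. coeff (p * q) i = 0"
proof -
  obtain p' q' where pq: "p = monom 1 j * p'" "q = monom 1 k * q'"
    using assms unfolding monom_1_dvd_iff'[symmetric] by (auto elim!: dvdE)
  have eq: "p * q = monom 1 (j + k) * (p' * q')"
    using mult_monom[of "1::'a" j 1 k] unfolding pq by (simp add: mult_ac)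
  show "\<forall>i<j + k. coeff (p * q) i = 0"
    unfolding eq by (simp add: coeff_monom_mult)
  show "coeff (p * q) (j + k) = coeff p j * coeff q k"
    unfolding eq by (simp add: coeff_monom_mult pq coeff_mult_0)
qed

lemma order_set_add:
  assumes "poly_subalgebra A" "j \<in> order_set m A" "k \<in> order_set m A" "j + k < m"
  shows "j + k \<in> order_set m A"
proof -
  obtain p q where pq: "p \<in> A" "coeff p j \<noteq> 0" "\<forall>i<j. coeff p i = 0"
    "q \<in> A" "coeff q k \<noteq> 0" "\<forall>i<k. coeff q i = 0"
    using assms by (auto simp: order_set_def)
  have "p * q \<in> A"
    using pq assms(1) by (simp add: poly_subalgebra_def)
  moreover have "coeff (p * q) (j + k) \<noteq> 0"
    using coeff_mult_lowest(1)[OF pq(3,6)] pq by simp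
  moreover have "1 \<le> j"
    using assms(2) by (simp add: order_set_def)
  ultimately show ?thesis
    using coeff_mult_lowest(2)[OF pq(3,6)] assms(4) unfolding order_set_def by auto
qed

text \<open>The order \<open>m - 1\<close> is excluded by the definition of
  \<open>subalgebras\<close>. If 1 were an order, additivity would make every positive number below
  \<open>m\<close> an order, \<open>m - 1\<close> included.\<close>

lemma order_set_in_truncated_semigroups:
  assumes A: "A \<in> subalgebras m" and "m \<ge> 4"
  shows "order_set m A \<in> truncated_semigroups m"
proof -
  have sub: "poly_subalgebra A"
    using A by (simp add: subalgebras_def)
  have pred: "m - 1 \<notin> order_set m A"
    using subalgebras_no_order_pred[OF A] by (auto simp: order_set_def)
  have one: "1 \<notin> order_set m A"
  proof
    assume 1: "1 \<in> order_set m A"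
    have "Suc k < m \<Longrightarrow> Suc k \<in> order_set m A" for k
      by (induction k) (use 1 order_set_add[OF sub, of _ m 1] in auto)
    from this[of "m - 2"] show False
      using pred \<open>m \<ge> 4\<close> by (simp add: Suc_diff_Suc numeral_2_eq_2)
  qed
  have "k \<in> {2..m - 2}" if "k \<in> order_set m A" for k
  proof -
    have "k \<noteq> 1" "k \<noteq> m - 1" "1 \<le> k" "k < m"
      using that one pred by (auto simp: order_set_def)
    then show ?thesis by auto
  qed
  then show ?thesis
    using order_set_add[OF sub] by (fastforce simp: truncated_semigroups_def set_plus_def)
qed

section \<open>Finite stabilizers have escaping order\<close>

lemma subalgebras_memI_monomials:
  assumes A: "A \<in> subalgebras m" and p: "\<And>i. i < m \<Longrightarrow> coeff p i \<noteq> 0 \<Longrightarrow> monom 1 i \<in> A"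
  shows "p \<in> A"
proof -
  have sub: "poly_subalgebra A"
    using A by (simp add: subalgebras_def)
  define q where "q = (\<Sum>i<m. smult (coeff p i) (monom 1 i))"
  have "smult (coeff p i) (monom 1 i) \<in> A" if "i < m" for i
    using p[OF that] sub poly_subalgebra_0[OF sub]
    by (cases "coeff p i = 0") (auto simp: poly_subalgebra_def)
  then have "q \<in> A"
    unfolding q_def by (intro poly_subalgebra_sum[OF sub]) auto
  moreover have "coeff q i = coeff p i" if "i < m" for i
    using that by (simp add: q_def coeff_sum if_distrib sum.delta cong: if_cong)
  then have "p - q \<in> A"
    by (intro subalgebras_contains_high_order[OF A]) simp
  ultimately have "q + (p - q) \<in> A"
    using sub unfolding poly_subalgebra_def by blast
  then show ?thesis by simp
qed

text \<open>By strong induction the monomials of \<open>p\<close> below \<open>i\<close> lie in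
  \<open>A\<close>. Subtracting these terms leaves an element of order \<open>i\<close>, so
  \<open>i\<close> is 0 or belongs to the order set.\<close>

lemma monom_mem_imp_support_mem:
  assumes A: "A \<in> subalgebras m" and mon: "\<And>k. k \<in> order_set m A \<Longrightarrow> monom 1 k \<in> A"
    and p: "p \<in> A" and "i < m" "coeff p i \<noteq> 0"
  shows "monom 1 i \<in> A"
  using assms(4,5)
proof (induction i rule: less_induct)
  case (less i)
  have sub: "poly_subalgebra A"
    using A by (simp add: subalgebras_def)
  show ?case
  proof (cases "i = 0")
    case True
    then show ?thesis using sub by (simp add: poly_subalgebra_def monom_0 flip: one_pCons)
  next
    case False
    define q where "q = (\<Sum>j<i. smult (coeff p j) (monom 1 j))"
    have "smult (coeff p j) (monom 1 j) \<in> A" if "j < i" for j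
      using less.IH[OF that] less.prems that sub poly_subalgebra_0[OF sub]
      by (cases "coeff p j = 0") (auto simp: poly_subalgebra_def)
    then have "q \<in> A"
      unfolding q_def by (intro poly_subalgebra_sum[OF sub]) auto
    then have "p - q \<in> A"
      by (rule poly_subalgebra_diff[OF sub p])
    moreover have "coeff q j = (if j < i then coeff p j else 0)" for j
      by (simp add: q_def coeff_sum if_distrib sum.delta cong: if_cong)
    then have "coeff (p - q) i \<noteq> 0" "\<forall>j<i. coeff (p - q) j = 0"
      using less.prems by auto
    ultimately have "i \<in> order_set m A"
      using less.prems(1) False unfolding order_set_def mem_Collect_eq by (metis One_nat_def Suc_leI neq0_conv)
    then show ?thesis by (rule mon)
  qed
qed

text \<open>
  Averaging over the stabilizer projects \<open>A\<close> onto its components with respect to the grading by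
  residues modulo \<open>n\<close>. If \<open>n\<close> does not escape, all exponents that survive are orders of elements
  of \<open>A\<close> and can be cleared from the top downwards.
\<close>
lemma monom_mem_of_nonescaping:
  fixes A :: "'k::field poly set"
  assumes A: "A \<in> subalgebras m" and G: "dilation_stabilizer A = {x. x ^ n = 1}"
    and n: "card {x::'k. x ^ n = 1} = n" "n > 0"
    and closed: "n +o order_set m A \<subseteq> order_set m A \<union> {m..}"
    and k: "k \<in> order_set m A \<union> {m..}"
  shows "monom 1 k \<in> A"
  using k
proof (induction "m - k" arbitrary: k rule: less_induct)
  case less
  have sub: "poly_subalgebra A"
    using A by (simp add: subalgebras_def)
  show ?case
  proof (cases "k < m")
    case False
    then show ?thesis by (intro subalgebras_contains_high_order[OF A]) auto
  next
    case True
    then obtain p where p: "p \<in> A" "coeff p k \<noteq> 0" "\<forall>i<k. coeff p i = 0"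
      using less.prems by (auto simp: order_set_def)
    \<comment> \<open>The weight \<open>inverse x ^ k\<close> turns coefficient \<open>i\<close>
      into a sum of powers \<open>x ^ (i - k)\<close>, which selects the exponents congruent to
      \<open>k\<close> modulo \<open>n\<close>.\<close>
    define q where "q = (\<Sum>x | x ^ n = 1. smult (inverse x ^ k) (dilate x p))"
    have "smult (inverse x ^ k) (dilate x p) \<in> A" if "x ^ n = 1" for x
    proof -
      have "x \<in> dilation_stabilizer A"
        using that G by blast
      then show ?thesis
        using p(1) sub by (simp add: dilation_stabilizer_def poly_subalgebra_def)
    qed
    then have qA: "q \<in> A"
      unfolding q_def by (intro poly_subalgebra_sum[OF sub]) auto
    \<comment> \<open>For \<open>i < k\<close> the difference \<open>i - k\<close> truncates to 0,
      but both sides are 0 because \<open>p\<close> has order \<open>k\<close>.\<close>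
    have coeff_q: "coeff q i = (if n dvd i - k then of_nat n * coeff p i else 0)" for i
    proof (cases "i < k")
      case True
      then show ?thesis using p(3) by (simp add: q_def coeff_sum)
    next
      case False
      have "inverse x ^ k * (x ^ i * coeff p i) = x ^ (i - k) * coeff p i" if "x ^ n = 1" for x
      proof -
        have "x \<noteq> 0"
          using that n(2) by (auto simp: zero_power)
        then show ?thesis
          using False by (simp add: power_diff power_inverse field_simps)
      qed
      then have "coeff q i = (\<Sum>x | x ^ n = 1. x ^ (i - k) * coeff p i)"
        unfolding q_def coeff_sum coeff_smult coeff_dilate by (intro sum.cong) auto
      also have "\<dots> = (\<Sum>x | x ^ n = 1. x ^ (i - k)) * coeff p i"
        by (simp add: sum_distrib_right)
      finally have "coeff q i = (\<Sum>x | x ^ n = 1. x ^ (i - k)) * coeff p i" .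
      then show ?thesis
        by (simp add: sum_power_roots_of_unity[OF n])
    qed
    have shift: "k + n * j \<in> order_set m A \<union> {m..}" for j
    proof (induction j)
      case (Suc j)
      then show ?case
        using closed by (auto simp: elt_set_plus_def algebra_simps)
    qed (use less.prems in simp)
    \<comment> \<open>The exponents below \<open>m\<close> in \<open>r\<close> have the form
      \<open>k + n * j\<close> with \<open>j > 0\<close>; they are orders above \<open>k\<close>, so
      their monomials lie in \<open>A\<close> by induction.\<close>
    define r where "r = q - smult (coeff q k) (monom 1 k)"
    have "r \<in> A"
    proof (rule subalgebras_memI_monomials[OF A])
      fix i assume i: "i < m" "coeff r i \<noteq> 0"
      then have "i \<noteq> k" "coeff q i \<noteq> 0"
        by (auto simp: r_def split: if_splits)
      then have "i > k" "n dvd i - k"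
        using p(3) by (auto simp: coeff_q nat_neq_iff split: if_splits)
      then have "i \<in> order_set m A \<union> {m..}"
        using shift by (metis dvdE le_add_diff_inverse less_imp_le)
      then show "monom 1 i \<in> A"
        using \<open>i > k\<close> i less.hyps by simp
    qed
    then have "smult (coeff q k) (monom 1 k) \<in> A"
      using poly_subalgebra_diff[OF sub qA] by (metis r_def diff_diff_eq2 add_diff_cancel_left')
    then have "smult (inverse (coeff q k)) (smult (coeff q k) (monom 1 k)) \<in> A"
      using sub unfolding poly_subalgebra_def by blast
    moreover have "of_nat n \<noteq> (0::'k)"
      using CHAR_not_dvd_card_roots_of_unity[OF n] by (simp add: of_nat_eq_0_iff_char_dvd)
    then have "coeff q k \<noteq> 0"
      using p(2) by (simp add: coeff_q)
    ultimately show ?thesis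
      by simp
  qed
qed

lemma finite_stabilizer_card_escapes:
  fixes A :: "'k::alg_closed_field poly set"
  assumes A: "A \<in> subalgebras m" and "m \<ge> 4" and fin: "finite (dilation_stabilizer A)"
  shows "card (dilation_stabilizer A) \<in> all_escaping_shifts_prime_to CHAR('k) m"
proof -
  define n where "n = card (dilation_stabilizer A)"
  have G: "dilation_stabilizer A = {x. x ^ n = 1}"
    unfolding n_def
    by (rule finite_mult_group_eq_roots_of_unity[OF fin one_in_dilation_stabilizer _ mult_in_dilation_stabilizer])
      (simp_all add: dilation_stabilizer_def)
  have "n > 0"
    using fin one_in_dilation_stabilizer[of A] by (auto simp: n_def card_gt_0_iff)
  have card: "card {x::'k. x ^ n = 1} = n"
    using G n_def by simp
  have "\<not> n +o order_set m A \<subseteq> order_set m A \<union> {m..}"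
  proof
    assume closed: "n +o order_set m A \<subseteq> order_set m A \<union> {m..}"
    have mon: "monom 1 k \<in> A" if "k \<in> order_set m A" for k
      using monom_mem_of_nonescaping[OF A G card \<open>n > 0\<close> closed] that by blast
    have dil: "dilate c p \<in> A" if "p \<in> A" for c p
      by (rule subalgebras_memI_monomials[OF A], rule monom_mem_imp_support_mem[OF A mon that]) auto
    \<comment> \<open>A root of \<open>x ^ (n + 1) - x + 1\<close> satisfies
      \<open>x * (x ^ n - 1) = -1\<close>; it is therefore nonzero and not an \<open>n\<close>-th
      root of unity, yet its dilation would preserve \<open>A\<close>.\<close>
    obtain x :: 'k where "poly (monom 1 (Suc n) + [:1, -1:]) x = 0"
    proof -
      have "coeff (monom 1 (Suc n) + [:1, -1:] :: 'k poly) (Suc n) = 1"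
        using \<open>n > 0\<close> by (simp add: coeff_pCons split: nat.splits)
      then have "degree (monom 1 (Suc n) + [:1, -1:] :: 'k poly) > 0"
        by (metis le_degree less_le_trans zero_less_Suc zero_neq_one)
      then show ?thesis
        using alg_closed_imp_poly_has_root that by blast
    qed
    then have x: "x * (x ^ n - 1) = -1"
      by (simp add: poly_monom algebra_simps eq_neg_iff_add_eq_0)
    then have "x \<noteq> 0"
      by auto
    then have "x \<in> dilation_stabilizer A"
      using dil by (intro dilation_stabilizerI)
    then show False
      using x G by simp
  qed
  \<comment> \<open>An order \<open>g\<close> that witnesses the escape satisfies
    \<open>n + g < m\<close>.\<close>
  moreover from this have "n \<le> m - 1"
    by (auto simp: elt_set_plus_def)
  ultimately have "n \<in> escaping_shifts_prime_to CHAR('k) m (order_set m A)"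
    using \<open>n > 0\<close> CHAR_not_dvd_card_roots_of_unity[OF card \<open>n > 0\<close>]
    by (simp add: escaping_shifts_prime_to_def)
  then show ?thesis
    using order_set_in_truncated_semigroups[OF A \<open>m \<ge> 4\<close>]
    by (auto simp: all_escaping_shifts_prime_to_def n_def)
qed

section \<open>Realization of escaping shifts\<close>

text \<open>This is \<open>K[f] + x ^ m K[x]\<close>: composition with \<open>f\<close> parametrizes
  \<open>K[f]\<close>, and cross terms of products fall into the ideal
  \<open>x ^ m K[x]\<close>.\<close>

definition generated_subalgebra :: "nat \<Rightarrow> 'k::field poly \<Rightarrow> 'k poly set" where
  "generated_subalgebra m f = {pcompose q f + monom 1 m * r | q r. True}"

lemma poly_subalgebra_generated: "poly_subalgebra (generated_subalgebra m f)"
proof -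
  let ?A = "generated_subalgebra m f"
  have memI: "p \<in> ?A" if "p = pcompose q f + monom 1 m * r" for p q r
    using that by (auto simp: generated_subalgebra_def)
  have "1 \<in> ?A"
    by (rule memI[of _ 1 0]) (simp add: pcompose_1)
  moreover have "p + p' \<in> ?A" "p * p' \<in> ?A" if pp: "p \<in> ?A" "p' \<in> ?A" for p p'
  proof -
    obtain q r q' r' where *: "p = pcompose q f + monom 1 m * r" "p' = pcompose q' f + monom 1 m * r'"
      using pp by (auto simp: generated_subalgebra_def)
    show "p + p' \<in> ?A"
      by (rule memI[of _ "q + q'" "r + r'"]) (simp add: * pcompose_add algebra_simps)
    show "p * p' \<in> ?A"
      by (rule memI[of _ "q * q'" "pcompose q f * r' + r * pcompose q' f + monom 1 m * r * r'"])
        (simp add: * pcompose_mult algebra_simps)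
  qed
  moreover have "smult c p \<in> ?A" if p: "p \<in> ?A" for c p
  proof -
    obtain q r where *: "p = pcompose q f + monom 1 m * r"
      using p by (auto simp: generated_subalgebra_def)
    show ?thesis
      by (rule memI[of _ "smult c q" "smult c r"]) (simp add: * pcompose_smult smult_add_right)
  qed
  ultimately show ?thesis
    by (simp add: poly_subalgebra_def)
qed

text \<open>The generator is \<open>x ^ g * u\<close> with \<open>u\<close> of constant term 1. If
  \<open>q = x ^ j * s\<close> with \<open>s\<close> nonzero at 0, then composing \<open>q\<close>
  with the generator gives order exactly \<open>g * j\<close>, and the summand in
  \<open>x ^ m K[x]\<close> does not affect orders below \<open>m\<close>.\<close>

lemma generated_subalgebra_order_dvd:
  fixes p :: "'k::field poly"
  assumes "l > 0" "g > 0" and p: "p \<in> generated_subalgebra m (monom 1 g + monom 1 (g + l))"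
    and k: "k < m" "coeff p k \<noteq> 0" "\<forall>i<k. coeff p i = 0"
  shows "g dvd k"
proof -
  define f :: "'k poly" where "f = monom 1 g + monom 1 (g + l)"
  define u :: "'k poly" where "u = 1 + monom 1 l"
  obtain q r where p: "p = pcompose q f + monom 1 m * r"
    using p by (auto simp: generated_subalgebra_def f_def)
  have low: "coeff p i = coeff (pcompose q f) i" if "i < m" for i
    using that by (simp add: p coeff_monom_mult)
  then have "q \<noteq> 0"
    using k by fastforce
  then obtain j s where q: "q = [:0, 1:] ^ j * s" "\<not> [:0, 1:] dvd s"
    using order_decomp[of q 0] by auto
  have s0: "poly s 0 \<noteq> 0"
    using q(2) by (simp add: poly_eq_0_iff_dvd)
  have f: "f = monom 1 g * u"
    by (simp add: f_def u_def distrib_left mult_monom)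
  have "pcompose ([:0, 1:] ^ j) f = f ^ j"
    by (induction j) (simp_all add: pcompose_1 pcompose_mult pcompose_pCons)
  then have comp: "pcompose q f = monom 1 (g * j) * (u ^ j * pcompose s f)"
    by (simp add: q(1) pcompose_mult f power_mult_distrib monom_power mult.assoc)
  have "coeff f 0 = 0" "coeff u 0 = 1"
    using assms by (simp_all add: f_def u_def)
  then have nz: "coeff (u ^ j * pcompose s f) 0 \<noteq> 0"
    using s0 by (simp add: coeff_mult_0 coeff_0_power)
  show ?thesis
  proof (cases "k < g * j")
    case True
    then show ?thesis using k low by (simp add: comp coeff_monom_mult)
  next
    case False
    then have "coeff p (g * j) \<noteq> 0"
      using nz k(1) low[of "g * j"] by (simp add: comp coeff_monom_mult)
    then have "k = g * j"
      using False k(3) by (metis nat_neq_iff)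
    then show ?thesis by simp
  qed
qed

text \<open>If \<open>c ^ l = 1\<close>, the dilation scales the generator \<open>f\<close> by
  \<open>c ^ g\<close> and so preserves \<open>K[f]\<close>. Conversely, the dilate of
  \<open>f\<close> minus \<open>c ^ g\<close> times \<open>f\<close> is a scalar multiple of
  \<open>x ^ (g + l)\<close> in \<open>A\<close>; since \<open>g\<close> does not divide
  \<open>g + l\<close>, that scalar is 0.\<close>

lemma dilation_stabilizer_generated:
  fixes l g m :: nat
  defines "A \<equiv> generated_subalgebra m (monom 1 g + monom (1::'k::field) (g + l))"
  assumes "l > 0" "g > 0" "g + l < m" "\<not> g dvd g + l"
  shows "dilation_stabilizer A = {c. c ^ l = 1}"
proof (intro equalityI subsetI)
  define f :: "'k poly" where "f = monom 1 g + monom 1 (g + l)"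
  fix c assume "c \<in> {c::'k. c ^ l = 1}"
  then have c: "c ^ l = 1"
    by simp
  have *: "dilate c p \<in> A" if "p \<in> A" and c: "c ^ l = 1" for p c
  proof -
    obtain q r where p: "p = pcompose q f + monom 1 m * r"
      using \<open>p \<in> A\<close> by (auto simp: A_def generated_subalgebra_def f_def)
    have "dilate c f = smult (c ^ g) f"
      using c by (intro poly_eqI) (auto simp: f_def power_add)
    then have "dilate c (pcompose q f) = pcompose (pcompose q [:0, c ^ g:]) f"
      by (simp add: dilate_def pcompose_pCons flip: pcompose_assoc)
    moreover have "dilate c (monom 1 m) = smult (c ^ m) (monom 1 m)"
      by (intro poly_eqI) simp
    ultimately have "dilate c p = pcompose (pcompose q [:0, c ^ g:]) f + monom 1 m * smult (c ^ m) (dilate c r)"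
      by (simp add: p)
    then show ?thesis
      unfolding A_def generated_subalgebra_def f_def by blast
  qed
  show "c \<in> dilation_stabilizer A"
    using c \<open>l > 0\<close> by (intro dilation_stabilizerI *) (auto simp: power_inverse zero_power)
next
  define f :: "'k poly" where "f = monom 1 g + monom 1 (g + l)"
  have sub: "poly_subalgebra A"
    unfolding A_def by (rule poly_subalgebra_generated)
  fix c assume c: "c \<in> dilation_stabilizer A"
  have "f = pcompose [:0, 1:] f + monom 1 m * 0"
    by (simp add: pcompose_pCons)
  then have "f \<in> A"
    unfolding A_def generated_subalgebra_def f_def by blast
  then have "dilate c f \<in> A" "smult (c ^ g) f \<in> A"
    using c sub by (simp_all add: dilation_stabilizer_def poly_subalgebra_def)
  then have "dilate c f - smult (c ^ g) f \<in> A"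
    by (rule poly_subalgebra_diff[OF sub])
  moreover have coeff: "coeff (dilate c f - smult (c ^ g) f) i = (if i = g + l then c ^ g * (c ^ l - 1) else 0)" for i
    using \<open>l > 0\<close> by (auto simp: f_def power_add algebra_simps)
  ultimately have "c ^ g * (c ^ l - 1) = 0"
    using generated_subalgebra_order_dvd[of l g _ m "g + l"] assms unfolding A_def by fastforce
  then show "c \<in> {c. c ^ l = 1}"
    using c by (simp add: dilation_stabilizer_def)
qed

lemma truncated_semigroups_multiple:
  assumes \<Gamma>: "\<Gamma> \<in> truncated_semigroups m" "g \<in> \<Gamma>" and "j > 0" "g * j < m"
  shows "g * j \<in> \<Gamma>"
  using assms(3,4)
proof (induction j)
  case (Suc j)
  show ?case
  proof (cases "j = 0")
    case True
    then show ?thesis using \<Gamma> by simp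
  next
    case False
    then have "g + g * j \<in> \<Gamma> + \<Gamma>"
      using Suc \<Gamma>(2) by (intro set_plus_intro) auto
    then show ?thesis
      using \<Gamma>(1) Suc.prems by (auto simp: truncated_semigroups_def)
  qed
qed simp

text \<open>Some \<open>g\<close> in \<Gamma> has \<open>g + l\<close> outside \<Gamma> and below
  \<open>m\<close>. All positive multiples of \<open>g\<close> below \<open>m\<close> lie in
  \<Gamma>, so \<open>g\<close> divides neither \<open>g + l\<close> nor \<open>m - 1\<close>. The
  former determines the stabilizer of the generated subalgebra, the latter keeps
  \<open>x ^ (m - 1)\<close> out of it.\<close>

lemma escaping_shift_realized:
  assumes "m \<ge> 4" and l: "l \<in> all_escaping_shifts_prime_to CHAR('k::alg_closed_field) m"
  obtains A :: "'k::alg_closed_field poly set"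
  where "A \<in> subalgebras m" "finite (dilation_stabilizer A)" "card (dilation_stabilizer A) = l"
proof -
  obtain \<Gamma> where \<Gamma>: "\<Gamma> \<in> truncated_semigroups m" and "l > 0" "\<not> CHAR('k) dvd l"
      and "\<not> l +o \<Gamma> \<subseteq> \<Gamma> \<union> {m..}"
    using l by (auto simp: all_escaping_shifts_prime_to_def escaping_shifts_prime_to_def)
  then obtain g where "g \<in> \<Gamma>" "l + g \<notin> \<Gamma>" "\<not> m \<le> l + g"
    by (auto simp: elt_set_plus_def)
  then have g: "g \<in> \<Gamma>" "g + l \<notin> \<Gamma>" "g + l < m"
    by (simp_all add: add.commute)
  have bounds: "k \<ge> 2 \<and> k \<le> m - 2" if "k \<in> \<Gamma>" for k
    using \<Gamma> that by (auto simp: truncated_semigroups_def)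
  have mem: "k \<in> \<Gamma>" if "g dvd k" "k > 0" "k < m" for k
    using that truncated_semigroups_multiple[OF \<Gamma> g(1)] by (metis dvdE nat_0_less_mult_iff)
  have "g > 0"
    using bounds[OF g(1)] by simp
  have ndvd: "\<not> g dvd g + l"
    using mem g \<open>g > 0\<close> by auto
  have ndvd': "\<not> g dvd m - 1"
    using mem[of "m - 1"] bounds[of "m - 1"] \<open>m \<ge> 4\<close> by auto
  define A where "A = generated_subalgebra m (monom 1 g + monom (1::'k) (g + l))"
  have "monom 1 m * r \<in> A" for r
  proof -
    have "monom 1 m * r = pcompose 0 (monom 1 g + monom (1::'k) (g + l)) + monom 1 m * r"
      by simp
    then show ?thesis
      unfolding A_def generated_subalgebra_def by blast
  qed
  moreover have "monom 1 (m - 1) \<notin> A"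
    using generated_subalgebra_order_dvd[OF \<open>l > 0\<close> \<open>g > 0\<close>, of "monom 1 (m - 1)" m "m - 1"] ndvd' \<open>m \<ge> 4\<close>
    by (auto simp: A_def)
  ultimately have "A \<in> subalgebras m"
    using poly_subalgebra_generated by (auto simp: subalgebras_def A_def)
  moreover have "dilation_stabilizer A = {c. c ^ l = 1}"
    unfolding A_def by (rule dilation_stabilizer_generated[OF \<open>l > 0\<close> \<open>g > 0\<close> g(3) ndvd])
  moreover have "of_nat l \<noteq> (0::'k)"
    using \<open>\<not> CHAR('k) dvd l\<close> by (simp add: of_nat_eq_0_iff_char_dvd)
  ultimately show ?thesis
    using that card_roots_of_unity roots_of_unity_bound(1)[OF \<open>l > 0\<close>] by metis
qed

section \<open>Both characteristics combined\<close>

text \<open>Only 0 is divisible by 0, and shifts are at least 1. With \<open>CHAR('k) = 0\<close>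
  the prime-to version thus covers characteristic 0, and both cases share one argument.\<close>

lemma all_escaping_shifts_prime_to_0: "all_escaping_shifts_prime_to 0 m = all_escaping_shifts m"
  by (auto simp: all_escaping_shifts_prime_to_def all_escaping_shifts_def
      escaping_shifts_prime_to_def escaping_shifts_def)

theorem theorem3p7:
  fixes m :: nat
  assumes "m \<ge> 4"
  shows "aut_orders TYPE('k::alg_closed_field) m =
    (if CHAR('k) = 0 then all_escaping_shifts m
     else all_escaping_shifts_prime_to CHAR('k) m)"
proof -
  have "m > 0"
    using assms by simp
  have fin: "finite (alg_automorphisms A) \<longleftrightarrow> finite (dilation_stabilizer A)"
    and card: "card (alg_automorphisms A) = card (dilation_stabilizer A)"
    if "A \<in> subalgebras m" for A :: "'k poly set"
    using bij_betw_dilation_stabilizer_alg_automorphisms[OF that \<open>m > 0\<close>]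
    by (auto dest: bij_betw_finite bij_betw_same_card)
  have "aut_orders TYPE('k) m = all_escaping_shifts_prime_to CHAR('k) m"
  proof (intro equalityI subsetI)
    fix n assume "n \<in> aut_orders TYPE('k) m"
    then show "n \<in> all_escaping_shifts_prime_to CHAR('k) m"
      using finite_stabilizer_card_escapes[OF _ assms] fin card by (auto simp: aut_orders_def)
  next
    fix l assume "l \<in> all_escaping_shifts_prime_to CHAR('k) m"
    then obtain A :: "'k poly set"
      where "A \<in> subalgebras m" "finite (dilation_stabilizer A)" "card (dilation_stabilizer A) = l"
      using escaping_shift_realized[OF assms] by blast
    then show "l \<in> aut_orders TYPE('k) m"
      using fin[of A] card[of A] unfolding aut_orders_def mem_Collect_eq by metis
  qed
  then show ?thesis
    by (simp add: all_escaping_shifts_prime_to_0)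
qed

end
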